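(* For integers $k\ge 2$ and $1\le m<n$, \[RR(\mathbf{V}_{m,n},\mathbf{A}_k)=n(k-1)+2.\]
   Context: The Boolean lattice $\mathbf{B}_N$ is the poset $(2^{[N]},\subseteq)$. A poset $\mathbf{Q}$ contains $\mathbf{P}$ as a subposet if there is an injection $\phi$ with $x\le_{\mathbf{P}} y$ iff $\phi(x)\le_{\mathbf{Q}}\phi(y)$. $\mathbf{V}_{m,n}$ is the poset on elements $x,y_1,\dots,y_m,z_1,\dots,z_n$ with order generated by $x<y_1<\cdots<y_m$ and $x<z_1<\cdots<z_n$. $\mathbf{A}_k$ is the antichain on $k$ elements. A colored copy of a poset is monochromatic if all its elements have the same color and rainbow if any two distinct elements have different colors. For posets $\mathbf{P},\mathbf{Q}$, the Boolean rainbow Ramsey number $RR(\mathbf{P},\mathbf{Q})$ is the smallest $N$ such that for every coloring (with any number of colors) of the elements of $\mathbf{B}_N$, there exists either a monochromatic subposet isomorphic to $\mathbf{P}$ or a rainbow subposet isomorphic to $\mathbf{Q}$. *)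

theory Defs
  imports Main "HOL-Library.Extended_Nat"
begin

text \<open>A poset is represented by its reflexive order relation; the carrier is the
  \<^const>\<open>Field\<close> of that relation.\<close>

definition boolean_lattice :: "nat \<Rightarrow> nat set rel" where
  "boolean_lattice N = {(A, B). A \<subseteq> B \<and> B \<subseteq> {1..N}}"

definition antichain_poset :: "nat \<Rightarrow> nat rel" where
  "antichain_poset k = Id_on {1..k}"

datatype v_elem = VX | VY nat | VZ nat

definition V_carrier :: "nat \<Rightarrow> nat \<Rightarrow> v_elem set" where
  "V_carrier m n = {VX} \<union> VY ` {1..m} \<union> VZ ` {1..n}"

definition V_covers :: "nat \<Rightarrow> nat \<Rightarrow> v_elem rel" where
  "V_covers m n =
     {(v, w). v = VX \<and> w = VY 1 \<and> 1 \<le> m} \<union> {(VY i, VY (i + 1)) | i. 1 \<le> i \<and> i < m} \<union>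
     {(v, w). v = VX \<and> w = VZ 1 \<and> 1 \<le> n} \<union> {(VZ j, VZ (j + 1)) | j. 1 \<le> j \<and> j < n}"

definition V_poset :: "nat \<Rightarrow> nat \<Rightarrow> v_elem rel" where
  "V_poset m n = Restr ((V_covers m n)\<^sup>*) (V_carrier m n)"

definition is_copy :: "'a rel \<Rightarrow> 'b rel \<Rightarrow> ('a \<Rightarrow> 'b) \<Rightarrow> bool" where
  "is_copy P Q \<phi> \<longleftrightarrow>
     inj_on \<phi> (Field P) \<and> \<phi> ` Field P \<subseteq> Field Q \<and>
     (\<forall>x\<in>Field P. \<forall>y\<in>Field P. (x, y) \<in> P \<longleftrightarrow> (\<phi> x, \<phi> y) \<in> Q)"

definition monochromatic :: "('b \<Rightarrow> 'c) \<Rightarrow> 'b set \<Rightarrow> bool" where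
  "monochromatic c S \<longleftrightarrow> (\<forall>a\<in>S. \<forall>b\<in>S. c a = c b)"

definition rainbow :: "('b \<Rightarrow> 'c) \<Rightarrow> 'b set \<Rightarrow> bool" where
  "rainbow c S \<longleftrightarrow> (\<forall>a\<in>S. \<forall>b\<in>S. a \<noteq> b \<longrightarrow> c a \<noteq> c b)"

text \<open>The Boolean lattice is finite, so colors in \<^typ>\<open>nat\<close> account for any number of colors.\<close>

definition rainbow_arrows :: "nat \<Rightarrow> 'a rel \<Rightarrow> 'b rel \<Rightarrow> bool" where
  "rainbow_arrows N P Q \<longleftrightarrow>
     (\<forall>c :: nat set \<Rightarrow> nat.
        (\<exists>\<phi>. is_copy P (boolean_lattice N) \<phi> \<and> monochromatic c (\<phi> ` Field P)) \<or>
        (\<exists>\<psi>. is_copy Q (boolean_lattice N) \<psi> \<and> rainbow c (\<psi> ` Field Q)))"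

text \<open>The infimum is taken in \<^typ>\<open>enat\<close> so that the value is \<open>\<infinity>\<close> when no suitable \<open>N\<close> exists;
  a finite value is therefore attained.\<close>

definition RR :: "'a rel \<Rightarrow> 'b rel \<Rightarrow> enat" where
  "RR P Q = (INF N\<in>{N. rainbow_arrows N P Q}. enat N)"

lemma Field_boolean_lattice: "Field (boolean_lattice N) = Pow {1..N}"
  by (auto simp: boolean_lattice_def Field_def)

lemma Partial_order_boolean_lattice: "Partial_order (boolean_lattice N)"
  unfolding partial_order_on_def preorder_on_def Field_boolean_lattice
  by (auto simp: boolean_lattice_def refl_on_def trans_def antisym_def)

lemma Field_antichain_poset: "Field (antichain_poset k) = {1..k}"
  by (auto simp: antichain_poset_def Field_def)

lemma Partial_order_antichain_poset: "Partial_order (antichain_poset k)"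
  unfolding partial_order_on_def preorder_on_def Field_antichain_poset
  by (auto simp: antichain_poset_def refl_on_def trans_def antisym_def)

lemma Field_V_poset: "Field (V_poset m n) = V_carrier m n"
  by (auto simp: V_poset_def Field_def)

lemma Partial_order_V_poset: "Partial_order (V_poset m n)"
proof -
  have "V_covers m n \<subseteq> measure (\<lambda>v. case v of VX \<Rightarrow> 0 | VY i \<Rightarrow> i | VZ j \<Rightarrow> j)"
    by (auto simp: V_covers_def)
  then have "acyclic (V_covers m n)"
    using acyclic_subset wf_acyclic wf_measure by metis
  then have "antisym ((V_covers m n)\<^sup>*)"
    by (rule acyclic_impl_antisym_rtrancl)
  then show ?thesis
    unfolding partial_order_on_def preorder_on_def Field_V_poset
    by (auto simp: V_poset_def refl_on_def trans_def antisym_def intro: rtrancl_trans)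
qed

lemma RR_eq_enat_iff:
  "RR P Q = enat N \<longleftrightarrow> rainbow_arrows N P Q \<and> (\<forall>M<N. \<not> rainbow_arrows M P Q)"
proof
  assume eq: "RR P Q = enat N"
  let ?S = "enat ` {N. rainbow_arrows N P Q}"
  have "?S \<noteq> {}"
    using eq by (auto simp: RR_def Inf_enat_def split: if_splits)
  then have "Inf ?S \<in> ?S"
    unfolding Inf_enat_def by (auto intro: LeastI)
  then have "rainbow_arrows N P Q"
    using eq by (auto simp: RR_def)
  moreover have "\<not> rainbow_arrows M P Q" if "M < N" for M
  proof
    assume "rainbow_arrows M P Q"
    then have "RR P Q \<le> enat M"
      unfolding RR_def by (intro INF_lower) simp
    then show False
      using eq that by simp
  qed
  ultimately show "rainbow_arrows N P Q \<and> (\<forall>M<N. \<not> rainbow_arrows M P Q)"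
    by blast
next
  assume *: "rainbow_arrows N P Q \<and> (\<forall>M<N. \<not> rainbow_arrows M P Q)"
  show "RR P Q = enat N"
    unfolding RR_def
  proof (rule antisym)
    show "(INF N\<in>{N. rainbow_arrows N P Q}. enat N) \<le> enat N"
      using * by (intro INF_lower) simp
    show "enat N \<le> (INF N\<in>{N. rainbow_arrows N P Q}. enat N)"
      using * by (intro INF_greatest) (auto simp: not_less[symmetric])
  qed
qed

end

theory Submission
  imports Defs
begin

text \<open>
  For the upper bound, call an interval \<open>[J, T)\<close> rich in a finite set \<open>K\<close> of colors if each of its
  saturated chains contains more than \<open>n \<cdot> |K|\<close> elements with a color in \<open>K\<close>. A rich interval
  contains a monochromatic \<open>V\<^bsub>m,n\<^esub>\<close>, by induction on \<open>|K|\<close>: let \<open>A\<close> be a minimal element with a color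
  in \<open>K\<close>. If no chain from \<open>A\<close> to \<open>T\<close> has more than \<open>n\<close> elements of the color of \<open>A\<close>, then \<open>[A, T)\<close>
  is rich in the other colors. Otherwise there is a chain of \<open>n\<close> such elements inside
  \<open>[A + b, T - e]\<close>; every element of \<open>[A + e, T - b]\<close> is incomparable to all of them, so either \<open>m\<close>
  elements of the color of \<open>A\<close> form a chain there, completing \<open>V\<^bsub>m,n\<^esub>\<close>, or, because \<open>m < n\<close>, the interval
  \<open>[A + e, T - b)\<close> is rich in the other colors.

  Now induct on \<open>k\<close>. Without a monochromatic \<open>V\<^bsub>m,n\<^esub>\<close> there is a rainbow \<open>A\<^bsub>k-1\<^esub>\<close> inside every
  \<open>(j, [N] - i)\<close>, and it is incomparable to all of \<open>[i, [N] - j]\<close>; hence without a rainbow \<open>A\<^bsub>k\<^esub>\<close> this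
  interval has at most \<open>k - 1\<close> colors. For fixed \<open>i\<close> and varying \<open>j\<close> these intervals overlap so much
  that they all have the same colors, so \<open>[i, [N])\<close> has at most \<open>k - 1\<close> colors and is rich in them.
\<close>

section \<open>Saturated chains and rich intervals\<close>

text \<open>For finite \<open>T\<close> and \<open>J\<close> inside it, these are the maximal chains
  of the half-open interval, with one set of each size from |J| to |T| - 1. Leaving out
  \<open>T\<close> lets a chain of [J, A) and a chain of [A, T) be joined without overlap.\<close>

definition sat_chain :: "'a set \<Rightarrow> 'a set \<Rightarrow> 'a set set \<Rightarrow> bool" where
  "sat_chain J T \<C> \<longleftrightarrow>
     chain_subset \<C> \<and> (\<forall>A\<in>\<C>. J \<subseteq> A \<and> A \<subset> T) \<and> finite \<C> \<and> card \<C> = card (T - J)"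

text \<open>A monochromatic copy given by its root \<open>A\<close> and its two branches. Only the
  upper end \<open>T\<close> is recorded, so a copy found in a smaller interval can be reused in a
  larger one.\<close>

definition vee :: "('a set \<Rightarrow> 'b) \<Rightarrow> nat \<Rightarrow> nat \<Rightarrow> 'a set \<Rightarrow> bool" where
  "vee c m n T \<longleftrightarrow>
     (\<exists>A Y Z. chain_subset Y \<and> chain_subset Z \<and> card Y = m \<and> card Z = n \<and>
        (\<forall>B\<in>Y \<union> Z. A \<subset> B \<and> B \<subseteq> T \<and> c B = c A) \<and>
        (\<forall>B\<in>Y. \<forall>C\<in>Z. \<not> B \<subseteq> C \<and> \<not> C \<subseteq> B))"

lemma vee_mono:
  assumes "vee c m n T" "T \<subseteq> T'"
  shows "vee c m n T'"
proof -
  obtain A Y Z where "chain_subset Y" "chain_subset Z" "card Y = m" "card Z = n"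
    and above: "\<forall>B\<in>Y \<union> Z. A \<subset> B \<and> B \<subseteq> T \<and> c B = c A"
    and "\<forall>B\<in>Y. \<forall>C\<in>Z. \<not> B \<subseteq> C \<and> \<not> C \<subseteq> B"
    using assms(1) unfolding vee_def by (elim exE conjE) (rule that)
  moreover have "\<forall>B\<in>Y \<union> Z. A \<subset> B \<and> B \<subseteq> T' \<and> c B = c A"
    using above subset_trans[OF _ assms(2)] by simp
  ultimately show ?thesis
    unfolding vee_def by (intro exI conjI)
qed

lemma sat_chain_append:
  assumes "sat_chain J A \<C>" "sat_chain A T \<D>" "J \<subseteq> A" "A \<subseteq> T" "finite T"
  shows "sat_chain J T (\<C> \<union> \<D>)"
proof -
  have C: "chain_subset \<C>" "finite \<C>" "card \<C> = card (A - J)" "\<And>B. B \<in> \<C> \<Longrightarrow> J \<subseteq> B \<and> B \<subset> A"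
    and D: "chain_subset \<D>" "finite \<D>" "card \<D> = card (T - A)" "\<And>B. B \<in> \<D> \<Longrightarrow> A \<subseteq> B \<and> B \<subset> T"
    using assms(1,2) unfolding sat_chain_def by auto
  have "B \<notin> \<D>" if "B \<in> \<C>" for B
    using C(4)[OF that] D(4)[of B] by auto
  then have "\<C> \<inter> \<D> = {}"
    by blast
  moreover have "card (T - J) = card (T - A) + card (A - J)"
  proof -
    have "T - J = (T - A) \<union> (A - J)" "(T - A) \<inter> (A - J) = {}"
      using assms by auto
    then show ?thesis
      using assms by (metis card_Un_disjoint finite_Diff finite_subset)
  qed
  ultimately have "card (\<C> \<union> \<D>) = card (T - J)"
    using C(2,3) D(2,3) by (simp add: card_Un_disjoint)
  moreover have "X \<subseteq> Y \<or> Y \<subseteq> X" if XY: "X \<in> \<C> \<union> \<D>" "Y \<in> \<C> \<union> \<D>" for X Y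
  proof -
    consider "X \<in> \<C>" "Y \<in> \<C>" | "X \<in> \<D>" "Y \<in> \<D>" | "X \<in> \<C>" "Y \<in> \<D>" | "X \<in> \<D>" "Y \<in> \<C>"
      using XY by blast
    then show ?thesis
      using C(1) D(1) C(4)[of X] C(4)[of Y] D(4)[of X] D(4)[of Y]
      by cases (auto simp: chain_subset_def)
  qed
  moreover have "J \<subseteq> B \<and> B \<subset> T" if "B \<in> \<C> \<union> \<D>" for B
    using that C(4)[of B] D(4)[of B] assms(3,4) by blast
  ultimately show ?thesis
    using C(2) D(2) unfolding sat_chain_def chain_subset_def by simp
qed

lemma sat_chain_single:
  assumes "x \<notin> A"
  shows "sat_chain A (insert x A) {A}"
proof -
  have "insert x A - A = {x}" using assms by auto
  then show ?thesis
    using assms unfolding sat_chain_def chain_subset_def by auto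
qed

lemma sat_chain_exists:
  assumes "finite T" "J \<subseteq> T"
  shows "\<exists>\<C>. sat_chain J T \<C>"
  using assms
proof (induction "card (T - J)" arbitrary: T)
  case 0
  then have "sat_chain J T {}"
    by (auto simp: sat_chain_def chain_subset_def)
  then show ?case ..
next
  case (Suc d)
  then have "T - J \<noteq> {}"
    by force
  then obtain x where x: "x \<in> T - J"
    by blast
  have "card (T - {x} - J) = d"
    using Suc.hyps(2) x Suc.prems(1) by (metis Diff_insert Diff_insert2 card_Diff_singleton diff_Suc_1)
  moreover have "J \<subseteq> T - {x}"
    using x Suc.prems by auto
  ultimately obtain \<C> where C: "sat_chain J (T - {x}) \<C>"
    using Suc.hyps(1)[of "T - {x}"] Suc.prems(1) by auto
  have "sat_chain (T - {x}) T {T - {x}}"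
    using sat_chain_single[of x "T - {x}"] x by (simp add: insert_absorb)
  then show ?case
    using sat_chain_append[OF C] Suc.prems \<open>J \<subseteq> T - {x}\<close> by blast
qed

lemma chain_subset_subset: "chain_subset \<C> \<Longrightarrow> \<D> \<subseteq> \<C> \<Longrightarrow> chain_subset \<D>"
  unfolding chain_subset_def by blast

lemma chain_subset_Union_Inter:
  assumes "finite \<C>" "\<C> \<noteq> {}" "chain_subset \<C>"
  shows "\<Union>\<C> \<in> \<C>" "\<Inter>\<C> \<in> \<C>"
proof -
  obtain M where "M \<in> \<C>" "\<forall>B\<in>\<C>. M \<subseteq> B \<longrightarrow> M = B"
    using finite_has_maximal[OF assms(1,2)] by blast
  then have "\<Union>\<C> = M"
    using assms(3) unfolding chain_subset_def by blast
  then show "\<Union>\<C> \<in> \<C>"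
    using \<open>M \<in> \<C>\<close> by simp
  obtain L where "L \<in> \<C>" "\<forall>B\<in>\<C>. B \<subseteq> L \<longrightarrow> L = B"
    using finite_has_minimal[OF assms(1,2)] by blast
  then have "L \<subseteq> B" if "B \<in> \<C>" for B
    using assms(3) that unfolding chain_subset_def by metis
  then have "\<Inter>\<C> = L"
    using \<open>L \<in> \<C>\<close> by (intro antisym Inter_lower Inter_greatest)
  then show "\<Inter>\<C> \<in> \<C>"
    using \<open>L \<in> \<C>\<close> by simp
qed

text \<open>Members of \<E> contain \<open>e\<close> and avoid \<open>b\<close>, members of
  \<open>Z\<close> contain \<open>b\<close> and avoid \<open>e\<close>; this alone makes the two
  branches incomparable.\<close>

lemma vee_if_opposite_chains:
  assumes "chain_subset \<E>" "finite \<E>" "m \<le> card {B\<in>\<E>. c B = c A}" "\<forall>B\<in>\<E>. insert e A \<subseteq> B \<and> B \<subseteq> T - {b}"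
    and "chain_subset Z" "card Z = n" "\<forall>B\<in>Z. insert b A \<subseteq> B \<and> B \<subseteq> T - {e} \<and> c B = c A"
    and "b \<notin> A" "e \<notin> A"
  shows "vee c m n T"
proof -
  obtain Y where Y: "Y \<subseteq> {B\<in>\<E>. c B = c A}" "card Y = m"
    using assms(3) by (rule obtain_subset_with_card_n) (rule that)
  show ?thesis
    unfolding vee_def
  proof (intro exI conjI)
    show "chain_subset Y"
      using chain_subset_subset[OF assms(1)] Y(1) by blast
    show "\<forall>B\<in>Y \<union> Z. A \<subset> B \<and> B \<subseteq> T \<and> c B = c A"
      using Y(1) assms(4,7,8,9) by blast
    show "\<forall>B\<in>Y. \<forall>C\<in>Z. \<not> B \<subseteq> C \<and> \<not> C \<subseteq> B"
      using Y(1) assms(4,7) by blast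
  qed (use Y assms in auto)
qed

text \<open>The budget is \<open>n\<close> elements per color: discarding the color of
  \<open>A\<close> may cost a saturated chain at most \<open>n\<close> counted elements, so the
  smaller interval stays rich in the remaining colors.\<close>

lemma vee_if_rich:
  fixes c :: "'a set \<Rightarrow> 'b"
  assumes "1 \<le> m" "m < n" "finite T" "J \<subseteq> T" "finite K"
    and "\<And>\<C>. sat_chain J T \<C> \<Longrightarrow> n * card K + 1 \<le> card {B\<in>\<C>. c B \<in> K}"
  shows "vee c m n T"
  using assms(3-)
proof (induction "card K" arbitrary: J T K)
  case 0
  then have "K = {}" by simp
  then show ?case
    \<comment> \<open>Some saturated chain exists, and the hypothesis would give it an element with
      a color in the empty set.\<close>
    using 0 sat_chain_exists[OF 0(2,3)] by fastforce
next
  case (Suc u)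
  let ?P = "{A. J \<subseteq> A \<and> A \<subset> T \<and> c A \<in> K}"
  have "finite ?P"
    by (rule finite_subset[of _ "Pow T"]) (use Suc.prems(1) in auto)
  moreover have "?P \<noteq> {}"
  proof -
    obtain \<C> where C: "sat_chain J T \<C>"
      using sat_chain_exists[OF Suc.prems(1,2)] by blast
    have "{B\<in>\<C>. c B \<in> K} \<noteq> {}"
      using Suc.prems(4)[OF C] by (intro notI) simp
    then obtain B where "B \<in> \<C>" "c B \<in> K"
      by blast
    moreover have "J \<subseteq> B \<and> B \<subset> T"
      using C \<open>B \<in> \<C>\<close> by (simp add: sat_chain_def)
    ultimately have "B \<in> ?P"
      by simp
    then show ?thesis
      by blast
  qed
  ultimately have "\<exists>A\<in>?P. \<forall>B\<in>?P. B \<subseteq> A \<longrightarrow> A = B"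
    by (rule finite_has_minimal)
  then obtain A where A: "A \<in> ?P" and Amin: "\<forall>B\<in>?P. B \<subseteq> A \<longrightarrow> A = B"
    by (elim bexE) (rule that)
  have AT: "A \<subseteq> T" and JA: "J \<subseteq> A" and finA: "finite A"
    using A Suc.prems(1) finite_subset by auto
  obtain \<C> where C: "sat_chain J A \<C>"
    using sat_chain_exists[OF finA JA] by blast
  \<comment> \<open>By minimality of \<open>A\<close>, the part of a chain strictly below
    \<open>A\<close> has no color in \<open>K\<close>, so prefixing it leaves the count unchanged
    and [A, T) inherits the richness.\<close>
  have rich: "n * card K + 1 \<le> card {B\<in>\<D>. c B \<in> K}" if D: "sat_chain A T \<D>" for \<D>
  proof -
    have "c B \<notin> K" if "B \<in> \<C>" for B
    proof
      assume "c B \<in> K"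
      moreover have B: "J \<subseteq> B" "B \<subset> A"
        using C that by (simp_all add: sat_chain_def)
      moreover have "B \<subset> T"
        using B(2) AT by (rule psubset_subset_trans)
      ultimately have "B \<in> ?P"
        by simp
      then show False
        using bspec[OF Amin, of B] B(2) by (simp add: psubset_eq)
    qed
    then have "{B\<in>\<C> \<union> \<D>. c B \<in> K} = {B\<in>\<D>. c B \<in> K}"
      by auto
    then show ?thesis
      using Suc.prems(4)[OF sat_chain_append[OF C D JA AT Suc.prems(1)]] by simp
  qed
  let ?K = "K - {c A}"
  have cardK: "card ?K = u" "finite ?K" "card K = Suc u"
    using A Suc.hyps(2) Suc.prems(3) by (auto simp: card_Diff_singleton)
  show ?case
  proof (cases "\<forall>\<D>. sat_chain A T \<D> \<longrightarrow> card {B\<in>\<D>. c B = c A} \<le> n")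
    case True
    have "n * card ?K + 1 \<le> card {B\<in>\<D>. c B \<in> ?K}" if D: "sat_chain A T \<D>" for \<D>
    proof -
      have "{B\<in>\<D>. c B \<in> K} \<subseteq> {B\<in>\<D>. c B = c A} \<union> {B\<in>\<D>. c B \<in> ?K}" by auto
      moreover have "finite ({B\<in>\<D>. c B = c A} \<union> {B\<in>\<D>. c B \<in> ?K})"
        using D by (simp add: sat_chain_def)
      ultimately have "card {B\<in>\<D>. c B \<in> K} \<le> card ({B\<in>\<D>. c B = c A} \<union> {B\<in>\<D>. c B \<in> ?K})"
        by (intro card_mono)
      also have "\<dots> \<le> card {B\<in>\<D>. c B = c A} + card {B\<in>\<D>. c B \<in> ?K}"
        by (rule card_Un_le)
      finally have "n * card K + 1 \<le> card {B\<in>\<D>. c B = c A} + card {B\<in>\<D>. c B \<in> ?K}"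
        using rich[OF D] by simp
      moreover have "card {B\<in>\<D>. c B = c A} \<le> n"
        using True D by simp
      ultimately show ?thesis
        using cardK by simp
    qed
    then show ?thesis
      using Suc.hyps(1)[of ?K T A] cardK AT Suc.prems(1) by blast
  next
    case False
    then obtain \<D> where D: "sat_chain A T \<D>" and Dn: "n < card {B\<in>\<D>. c B = c A}"
      by (meson not_le)
    \<comment> \<open>More than \<open>n\<close> elements were found because \<open>A\<close> itself
      may be one of them and cannot serve in the branch.\<close>
    have "n \<le> card ({B\<in>\<D>. c B = c A} - {A})"
      using Dn diff_card_le_card_Diff[of "{A}" "{B\<in>\<D>. c B = c A}"] by simp
    then obtain Z where Z: "Z \<subseteq> {B\<in>\<D>. c B = c A} - {A}" "card Z = n"
      by (rule obtain_subset_with_card_n) (rule that)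
    have Zfin: "finite Z" "Z \<noteq> {}"
      using Z(2) assms(2) by (auto intro: card_ge_0_finite)
    have Zchain: "chain_subset Z"
      by (rule chain_subset_subset[of \<D>]) (use D Z(1) in \<open>auto simp: sat_chain_def\<close>)
    have "\<Inter>Z \<in> Z" "\<Union>Z \<in> Z"
      using chain_subset_Union_Inter[OF Zfin Zchain] by auto
    moreover have Zbetween: "A \<subset> B \<and> B \<subset> T \<and> c B = c A" if "B \<in> Z" for B
      using D Z(1) that by (auto simp: sat_chain_def)
    ultimately have "A \<subset> \<Inter>Z" "\<Union>Z \<subset> T"
      by simp_all
    \<comment> \<open>The intersection and the union of \<open>Z\<close> are its least and greatest
      members. So \<open>b\<close> lies in every member of \<open>Z\<close> but not in
      \<open>A\<close>, and \<open>e\<close> lies in \<open>T\<close> but in no member of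
      \<open>Z\<close>.\<close>
    then obtain b e where b: "b \<in> \<Inter>Z" "b \<notin> A" and e: "e \<in> T" "e \<notin> \<Union>Z"
      by blast
    have Z': "\<forall>B\<in>Z. insert b A \<subseteq> B \<and> B \<subseteq> T - {e} \<and> c B = c A"
      using Zbetween b e by (simp add: subset_Diff_insert psubset_imp_subset)
    obtain B where "B \<in> Z"
      using Zfin(2) by blast
    then have "A \<subset> B" "B \<subset> T" "b \<in> B" "e \<notin> B"
      using Zbetween[of B] b e by simp_all
    then have be: "b \<noteq> e" "b \<in> T" "e \<notin> A"
      by auto
    show ?thesis
    proof (rule ccontr)
      assume no: "\<not> vee c m n T"
      have "n * card ?K + 1 \<le> card {B\<in>\<E>. c B \<in> ?K}"
        if E: "sat_chain (insert e A) (T - {b}) \<E>" for \<E>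
      proof -
        \<comment> \<open>Framing \<E> with \<open>A\<close> below and \<open>T - {b}\<close> above
          gives a saturated chain of [A, T), to which \<open>rich\<close> applies.\<close>
        have "sat_chain (T - {b}) T {T - {b}}"
          using sat_chain_single[of b "T - {b}"] be by (simp add: insert_absorb)
        then have "sat_chain (insert e A) T (\<E> \<union> {T - {b}})"
          by (rule sat_chain_append[OF E]) (use Suc.prems(1) AT b be e in auto)
        then have full: "sat_chain A T ({A} \<union> (\<E> \<union> {T - {b}}))"
          by (rule sat_chain_append[OF sat_chain_single[OF be(3)]]) (use Suc.prems(1) AT e in auto)
        have "card {B\<in>\<E>. c B = c A} < m"
        proof (rule ccontr)
          assume "\<not> card {B\<in>\<E>. c B = c A} < m"
          then have "vee c m n T"
            by (intro vee_if_opposite_chains[of \<E> m c A e T b Z n] Z' Zchain Z(2) b(2) be(3))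
              (use E in \<open>simp_all add: sat_chain_def psubset_eq\<close>)
          then show False
            using no by blast
        qed
        moreover have "{B\<in>{A} \<union> (\<E> \<union> {T - {b}}). c B \<in> K}
            \<subseteq> {A, T - {b}} \<union> ({B\<in>\<E>. c B = c A} \<union> {B\<in>\<E>. c B \<in> ?K})" (is "?L \<subseteq> ?R")
          by auto
        moreover have "finite ?R"
          using E unfolding sat_chain_def by simp
        ultimately have "card ?L \<le> 2 + (card {B\<in>\<E>. c B = c A} + card {B\<in>\<E>. c B \<in> ?K})"
        proof -
          have "card ?L \<le> card ?R"
            by (rule card_mono) fact+
          also have "\<dots> \<le> card {A, T - {b}} + card ({B\<in>\<E>. c B = c A} \<union> {B\<in>\<E>. c B \<in> ?K})"
            by (rule card_Un_le)
          also have "\<dots> \<le> 2 + (card {B\<in>\<E>. c B = c A} + card {B\<in>\<E>. c B \<in> ?K})"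
            by (intro add_mono card_Un_le) (simp add: card_insert_if)
          finally show ?thesis .
        qed
        \<comment> \<open>The loss is at most m - 1 elements of the color of \<open>A\<close> in
          \<E> and the two framing sets, hence at most m + 1, which is within the budget because m <
          n.\<close>
        then show ?thesis
          using rich[OF full] \<open>card {B\<in>\<E>. c B = c A} < m\<close> assms(1,2) cardK by simp
      qed
      moreover have "insert e A \<subseteq> T - {b}"
        using be e b AT by blast
      ultimately have "vee c m n (T - {b})"
        using Suc.hyps(1)[of ?K "T - {b}" "insert e A"] cardK Suc.prems(1) by blast
      then show False
        using no vee_mono by (metis Diff_subset)
    qed
  qed
qed

text \<open>If \<open>K\<close> consists of all colors of the interval, every element of a saturated
  chain counts, so richness reduces to comparing n |K| with the length |T - J|.\<close>

lemma many_colors: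
  assumes "1 \<le> m" "m < n" "finite T" "J \<subseteq> T" "\<not> vee c m n T" "n * u + 1 \<le> card (T - J)"
  shows "u < card (c ` {A. J \<subseteq> A \<and> A \<subset> T})"
proof (rule ccontr)
  let ?K = "c ` {A. J \<subseteq> A \<and> A \<subset> T}"
  assume "\<not> u < card ?K"
  then have "n * card ?K + 1 \<le> card (T - J)"
    using assms(6) by (meson add_le_mono1 le_trans linorder_not_le mult_le_mono2)
  moreover have "{B\<in>\<C>. c B \<in> ?K} = \<C>" if "sat_chain J T \<C>" for \<C>
    using that unfolding sat_chain_def by blast
  moreover have "finite ?K"
    by (rule finite_imageI[OF finite_subset[of _ "Pow T"]]) (use assms(3) in auto)
  ultimately have "vee c m n T"
    using vee_if_rich[OF assms(1-4), of ?K c] by (simp add: sat_chain_def)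
  then show False
    using assms(5) by blast
qed

section \<open>Rainbow antichains\<close>

definition rainbow_antichain :: "('a set \<Rightarrow> 'b) \<Rightarrow> nat \<Rightarrow> 'a set \<Rightarrow> 'a set \<Rightarrow> 'a set set \<Rightarrow> bool" where
  "rainbow_antichain c k J T M \<longleftrightarrow>
     finite M \<and> card M = k \<and> (\<forall>A\<in>M. J \<subset> A \<and> A \<subset> T) \<and> (\<forall>A\<in>M. \<forall>B\<in>M. A \<subseteq> B \<longrightarrow> A = B) \<and> inj_on c M"

text \<open>Members of \<open>M\<close> contain \<open>j\<close> and avoid \<open>i\<close>, while
  sets of the opposite interval contain \<open>i\<close> and avoid \<open>j\<close>. Hence such a
  set with a color missing from \<open>M\<close> would extend \<open>M\<close> to a larger rainbow
  antichain.\<close>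

lemma opposite_interval_colors:
  assumes M: "rainbow_antichain c k (insert j J) (T - {i}) M"
    and no: "\<nexists>M. rainbow_antichain c (Suc k) J T M"
    and "i \<in> T - J" "j \<in> T - J"
  shows "c ` {A. insert i J \<subseteq> A \<and> A \<subseteq> T - {j}} \<subseteq> c ` M"
proof
  fix x assume "x \<in> c ` {A. insert i J \<subseteq> A \<and> A \<subseteq> T - {j}}"
  then obtain A where A: "insert i J \<subseteq> A" "A \<subseteq> T - {j}" "x = c A"
    by blast
  have btw: "insert j J \<subset> B \<and> B \<subset> T - {i}" if "B \<in> M" for B
    using M that by (simp add: rainbow_antichain_def)
  have inc: "\<not> A \<subseteq> B \<and> \<not> B \<subseteq> A" if "B \<in> M" for B
  proof -
    have "i \<in> A" "j \<notin> A" "i \<notin> B" "j \<in> B"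
      using btw[OF that] A by auto
    then show ?thesis by auto
  qed
  then have "A \<notin> M" by auto
  show "x \<in> c ` M"
  proof (rule ccontr)
    assume x: "x \<notin> c ` M"
    have "rainbow_antichain c (Suc k) J T (insert A M)"
      unfolding rainbow_antichain_def
    proof (intro conjI)
      have "J \<subset> A" "A \<subset> T"
        using A assms(3,4) by auto
      moreover have "J \<subset> B" "B \<subset> T" if "B \<in> M" for B
        using btw[OF that] by auto
      ultimately show "\<forall>B\<in>insert A M. J \<subset> B \<and> B \<subset> T"
        by simp
    qed (use M A inc x \<open>A \<notin> M\<close> in \<open>auto simp: rainbow_antichain_def\<close>)
    then show False
      using no by blast
  qed
qed

lemma rainbow_antichain_exists:
  fixes c :: "'a set \<Rightarrow> 'b"
  assumes "1 \<le> m" "m < n" "finite T" "J \<subseteq> T" "\<not> vee c m n T" "n * k + 2 \<le> card (T - J)"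
  shows "\<exists>M. rainbow_antichain c (Suc k) J T M"
  using assms(3-)
proof (induction k arbitrary: J T)
  case 0
  then obtain a where a: "a \<in> T - J"
    by (metis all_not_in_conv card.empty add_0 mult_0_right not_numeral_le_zero)
  \<comment> \<open>A second element outside \<open>J\<close> keeps \<open>insert a J\<close>
    strictly below \<open>T\<close>.\<close>
  have "T - J \<noteq> {a}"
    using 0 by auto
  then have "rainbow_antichain c (Suc 0) J T {insert a J}"
    using a 0 unfolding rainbow_antichain_def by auto
  then show ?case by blast
next
  case (Suc k)
  note d = Suc.prems(4)
  show ?case
  proof (rule ccontr)
    assume no: "\<nexists>M. rainbow_antichain c (Suc (Suc k)) J T M"
    define col where "col i j = c ` {A. insert i J \<subseteq> A \<and> A \<subseteq> T - {j}}" for i j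
    have fin: "finite (T - J)"
      using Suc.prems(1) by simp
    have col_le: "finite (col i j)" "card (col i j) \<le> Suc k"
      if ij: "i \<in> T - J" "j \<in> T - J" "i \<noteq> j" for i j
    proof -
      have "T - {i} - insert j J = (T - J) - {i, j}" by auto
      \<comment> \<open>Removing \<open>i\<close> and \<open>j\<close> costs two elements; the extra
        \<open>n\<close> in the hypothesis covers this since n is at least 2.\<close>
      then have "n * k + 2 \<le> card (T - {i} - insert j J)"
        using ij fin d assms(1,2) by (simp add: card_Diff_subset)
      moreover have "\<not> vee c m n (T - {i})"
        using Suc.prems(3) vee_mono by (metis Diff_subset)
      moreover have "insert j J \<subseteq> T - {i}"
        using ij Suc.prems(2) by auto
      ultimately obtain M where M: "rainbow_antichain c (Suc k) (insert j J) (T - {i}) M"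
        using Suc.IH[of "T - {i}" "insert j J"] Suc.prems(1) by auto
      have "col i j \<subseteq> c ` M"
        unfolding col_def using opposite_interval_colors[OF M no ij(1,2)] .
      moreover have "finite (c ` M)" "card (c ` M) = Suc k"
        using M unfolding rainbow_antichain_def by (simp_all add: card_image)
      ultimately show "finite (col i j)" "card (col i j) \<le> Suc k"
        using finite_subset card_mono by metis+
    qed
    have col_eq: "col i j = col i l"
      if ij: "i \<in> T - J" "j \<in> T - J" "l \<in> T - J" "i \<noteq> j" "i \<noteq> l" "j \<noteq> l" for i j l
    proof -
      \<comment> \<open>The overlap of the two intervals loses three elements and still has at least
        k + 1 colors. Each interval has at most k + 1, so both have exactly the colors of the
        overlap.\<close>
      let ?S = "c ` {A. insert i J \<subseteq> A \<and> A \<subset> T - {j, l}}"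
      have "T - {j, l} - insert i J = (T - J) - {i, j, l}" by auto
      moreover have "card ((T - J) - {i, j, l}) = card (T - J) - 3"
        using ij fin by (subst card_Diff_subset) auto
      ultimately have "n * k + 1 \<le> card (T - {j, l} - insert i J)"
        using d assms(1,2) by simp
      moreover have "\<not> vee c m n (T - {j, l})"
        using Suc.prems(3) vee_mono by (metis Diff_subset)
      moreover have "insert i J \<subseteq> T - {j, l}"
        using ij Suc.prems(2) by auto
      ultimately have "k < card ?S"
        using Suc.prems(1) by (intro many_colors[OF assms(1,2)]) auto
      moreover have "?S \<subseteq> col i j" "?S \<subseteq> col i l"
        unfolding col_def by blast+
      moreover have "finite (col i j)" "card (col i j) \<le> Suc k" "finite (col i l)" "card (col i l) \<le> Suc k"
        using col_le[of i j] col_le[of i l] ij by simp_all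
      ultimately have "?S = col i j" "?S = col i l"
        by (simp_all add: card_seteq)
      then show ?thesis
        by simp
    qed
    have "2 \<le> card (T - J)"
      using d by simp
    then obtain i j where ij: "i \<in> T - J" "j \<in> T - J" "i \<noteq> j"
      by (meson card_2_iff' obtain_subset_with_card_n subset_eq)
    let ?S = "c ` {A. insert i J \<subseteq> A \<and> A \<subset> T}"
    \<comment> \<open>A proper subset of \<open>T\<close> misses some \<open>l\<close>, hence lies
      in the closed interval up to \<open>T - {l}\<close>, whose colors agree with those for
      \<open>j\<close>.\<close>
    have "?S \<subseteq> col i j"
    proof
      fix x assume "x \<in> ?S"
      then obtain A l where A: "insert i J \<subseteq> A" "A \<subset> T" "x = c A" "l \<in> T" "l \<notin> A"
        by blast
      then have "x \<in> col i l"
        unfolding col_def by blast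
      moreover have "l \<in> T - J" "i \<noteq> l"
        using A by auto
      ultimately show "x \<in> col i j"
        using col_eq[of i l j] ij by blast
    qed
    then have "card ?S \<le> Suc k"
      using col_le[OF ij] by (meson card_mono order_trans)
    \<comment> \<open>Only \<open>i\<close> is lost here, and the additive 2 of the threshold leaves
      exactly the 1 that \<open>many_colors\<close> requires for more than \<open>Suc k\<close>
      colors.\<close>
    moreover have "n * Suc k + 1 \<le> card (T - insert i J)"
    proof -
      have "T - insert i J = (T - J) - {i}" by auto
      then show ?thesis
        using d ij by (simp add: card_Diff_singleton)
    qed
    ultimately show False
      using many_colors[OF assms(1,2) Suc.prems(1) _ Suc.prems(3), of "insert i J" "Suc k"] ij(1) Suc.prems(2)
      by auto
  qed
qed

section \<open>Copies in the Boolean lattice\<close>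

text \<open>Replaces the closure of the cover relation by explicit comparisons. One direction is
  induction along a path of covers; the other climbs a branch, by induction on the distance
  \<open>d\<close>.\<close>

lemma V_poset_iff:
  "(v, w) \<in> V_poset m n \<longleftrightarrow> v \<in> V_carrier m n \<and> w \<in> V_carrier m n \<and>
     (v = VX \<or> (\<exists>i j. i \<le> j \<and> (v = VY i \<and> w = VY j \<or> v = VZ i \<and> w = VZ j)))"
    (is "_ \<longleftrightarrow> _ \<and> _ \<and> ?R v w")
proof -
  have sound: "?R v w" if "(v, w) \<in> (V_covers m n)\<^sup>*" "v \<in> V_carrier m n"
    using that
  proof (induction rule: rtrancl_induct)
    case base
    then show ?case by (auto simp: V_carrier_def)
  next
    case (step w w')
    then show ?case by (fastforce simp: V_covers_def)
  qed
  have Y: "(VY i, VY (i + d)) \<in> (V_covers m n)\<^sup>*" if "1 \<le> i" "i + d \<le> m" for i d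
    using that
  proof (induction d)
    case (Suc d)
    then have "(VY (i + d), VY (i + Suc d)) \<in> V_covers m n"
      by (auto simp: V_covers_def)
    then show ?case
      using Suc by (auto intro: rtrancl_into_rtrancl)
  qed simp
  have Z: "(VZ i, VZ (i + d)) \<in> (V_covers m n)\<^sup>*" if "1 \<le> i" "i + d \<le> n" for i d
    using that
  proof (induction d)
    case (Suc d)
    then have "(VZ (i + d), VZ (i + Suc d)) \<in> V_covers m n"
      by (auto simp: V_covers_def)
    then show ?case
      using Suc by (auto intro: rtrancl_into_rtrancl)
  qed simp
  have XY: "(VX, VY j) \<in> (V_covers m n)\<^sup>*" if "1 \<le> j" "j \<le> m" for j
    using Y[of 1 "j - 1"] that
    by (auto simp: V_covers_def intro: converse_rtrancl_into_rtrancl)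
  have XZ: "(VX, VZ j) \<in> (V_covers m n)\<^sup>*" if "1 \<le> j" "j \<le> n" for j
    using Z[of 1 "j - 1"] that
    by (auto simp: V_covers_def intro: converse_rtrancl_into_rtrancl)
  have complete: "(v, w) \<in> (V_covers m n)\<^sup>*" if "?R v w" "v \<in> V_carrier m n" "w \<in> V_carrier m n"
  proof -
    have "VX = v \<or> (\<exists>i d. v = VY i \<and> w = VY (i + d) \<and> 1 \<le> i \<and> i + d \<le> m) \<or>
        (\<exists>i d. v = VZ i \<and> w = VZ (i + d) \<and> 1 \<le> i \<and> i + d \<le> n)"
      using that by (auto simp: V_carrier_def le_iff_add)
    then show ?thesis
      using that(3) XY XZ Y Z by (auto simp: V_carrier_def)
  qed
  show ?thesis
    using sound complete by (auto simp: V_poset_def)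
qed

text \<open>The union of a nonempty finite chain is its largest member; it receives the last index
  and the rest is enumerated by induction.\<close>

lemma chain_subset_enumerate:
  assumes "chain_subset \<C>" "finite \<C>" "card \<C> = n"
  shows "\<exists>f. f ` {1..n} = \<C> \<and> (\<forall>i\<in>{1..n}. \<forall>j\<in>{1..n}. f i \<subseteq> f j \<longleftrightarrow> i \<le> j)"
  using assms
proof (induction n arbitrary: \<C>)
  case 0
  then show ?case by simp
next
  case (Suc n)
  have U: "\<Union>\<C> \<in> \<C>"
    using chain_subset_Union_Inter(1) Suc.prems by fastforce
  have "chain_subset (\<C> - {\<Union>\<C>})" "card (\<C> - {\<Union>\<C>}) = n" "finite (\<C> - {\<Union>\<C>})"
    using Suc.prems U by (auto simp: chain_subset_def card_Diff_singleton)
  then obtain f where f: "f ` {1..n} = \<C> - {\<Union>\<C>}" "\<forall>i\<in>{1..n}. \<forall>j\<in>{1..n}. f i \<subseteq> f j \<longleftrightarrow> i \<le> j"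
    using Suc.IH[of "\<C> - {\<Union>\<C>}"] by auto
  have less: "f i \<subset> \<Union>\<C>" if "i \<in> {1..n}" for i
    using f(1) that by blast
  let ?g = "f(Suc n := \<Union>\<C>)"
  have "?g ` {1..n} = f ` {1..n}"
    by (rule image_cong) auto
  moreover have "{1..Suc n} = insert (Suc n) {1..n}"
    by auto
  ultimately have "?g ` {1..Suc n} = insert (\<Union>\<C>) (f ` {1..n})"
    by (simp only: image_insert fun_upd_same)
  then have "?g ` {1..Suc n} = \<C>"
    using f(1) insert_Diff[OF U] by simp
  moreover have "?g i \<subseteq> ?g j \<longleftrightarrow> i \<le> j" if "i \<in> {1..Suc n}" "j \<in> {1..Suc n}" for i j
    using f(2) that less[of i] less[of j] by (cases "i = Suc n"; cases "j = Suc n") auto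
  ultimately show ?case
    by blast
qed

lemma copy_if_vee:
  assumes "1 \<le> m" "1 \<le> n" "vee c m n {1..N}"
  shows "\<exists>\<phi>. is_copy (V_poset m n) (boolean_lattice N) \<phi> \<and> monochromatic c (\<phi> ` Field (V_poset m n))"
proof -
  obtain A Y Z where YZ: "chain_subset Y" "chain_subset Z" "card Y = m" "card Z = n"
    and above: "\<forall>B\<in>Y \<union> Z. A \<subset> B \<and> B \<subseteq> {1..N} \<and> c B = c A"
    and inc: "\<forall>B\<in>Y. \<forall>C\<in>Z. \<not> B \<subseteq> C \<and> \<not> C \<subseteq> B"
    using assms(3) unfolding vee_def by (elim exE conjE) (rule that)
  \<comment> \<open>An infinite set has \<open>card\<close> 0, so positive cardinalities force
    finiteness.\<close>
  have fin: "finite Y" "finite Z"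
    using YZ assms by (auto intro: card_ge_0_finite)
  obtain f where f: "f ` {1..m} = Y" "\<forall>i\<in>{1..m}. \<forall>j\<in>{1..m}. f i \<subseteq> f j \<longleftrightarrow> i \<le> j"
    using chain_subset_enumerate[OF YZ(1) fin(1) YZ(3)] by (elim exE conjE) (rule that)
  obtain g where g: "g ` {1..n} = Z" "\<forall>i\<in>{1..n}. \<forall>j\<in>{1..n}. g i \<subseteq> g j \<longleftrightarrow> i \<le> j"
    using chain_subset_enumerate[OF YZ(2) fin(2) YZ(4)] by (elim exE conjE) (rule that)
  define \<phi> where "\<phi> v = (case v of VX \<Rightarrow> A | VY i \<Rightarrow> f i | VZ i \<Rightarrow> g i)" for v
  have fY: "f i \<in> Y" if "1 \<le> i" "i \<le> m" for i using f(1) that by auto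
  have gZ: "g i \<in> Z" if "1 \<le> i" "i \<le> n" for i using g(1) that by auto
  have f_above: "A \<subset> f i \<and> f i \<subseteq> {1..N} \<and> c (f i) = c A" if "1 \<le> i" "i \<le> m" for i
    using above fY[OF that] by simp
  have g_above: "A \<subset> g i \<and> g i \<subseteq> {1..N} \<and> c (g i) = c A" if "1 \<le> i" "i \<le> n" for i
    using above gZ[OF that] by simp
  have fg: "\<not> f i \<subseteq> g j \<and> \<not> g j \<subseteq> f i" if "1 \<le> i" "i \<le> m" "1 \<le> j" "j \<le> n" for i j
    using inc fY[OF that(1,2)] gZ[OF that(3,4)] by simp
  have sub: "\<phi> v \<subseteq> {1..N} \<and> c (\<phi> v) = c A" if "v \<in> V_carrier m n" for v
  proof -
    \<comment> \<open>\<open>vee\<close> bounds only the branches by the top set; the root is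
      bounded through the first element of a branch.\<close>
    have "A \<subseteq> {1..N}"
      using f_above[of 1] assms(1) by blast
    then show ?thesis
      using that f_above g_above by (cases v) (simp_all add: V_carrier_def \<phi>_def image_iff)
  qed
  have iff: "(v, w) \<in> V_poset m n \<longleftrightarrow> \<phi> v \<subseteq> \<phi> w" if vw: "v \<in> V_carrier m n" "w \<in> V_carrier m n" for v w
  proof -
    have "A \<subseteq> f i" "\<not> f i \<subseteq> A" if "1 \<le> i" "i \<le> m" for i
      using f_above[OF that] by auto
    moreover have "A \<subseteq> g i" "\<not> g i \<subseteq> A" if "1 \<le> i" "i \<le> n" for i
      using g_above[OF that] by auto
    ultimately show ?thesis
      using vw f(2) g(2) fg unfolding V_poset_iff
      by (cases v; cases w) (simp_all add: V_carrier_def \<phi>_def image_iff)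
  qed
  \<comment> \<open>Equal images are comparable both ways, so antisymmetry of the V order gives
    injectivity.\<close>
  have "inj_on \<phi> (V_carrier m n)"
  proof (rule inj_onI)
    fix v w assume vw: "v \<in> V_carrier m n" "w \<in> V_carrier m n" "\<phi> v = \<phi> w"
    then have "(v, w) \<in> V_poset m n" "(w, v) \<in> V_poset m n"
      using iff by auto
    then show "v = w"
      using Partial_order_V_poset by (meson antisymD partial_order_on_def)
  qed
  then have "is_copy (V_poset m n) (boolean_lattice N) \<phi>"
    using iff sub unfolding is_copy_def Field_V_poset Field_boolean_lattice
    by (simp add: boolean_lattice_def image_subset_iff)
  moreover have "monochromatic c (\<phi> ` Field (V_poset m n))"
    using sub unfolding monochromatic_def Field_V_poset by simp
  ultimately show ?thesis by blast
qed

lemma copy_if_rainbow_antichain: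
  assumes "rainbow_antichain c k J {1..N} M"
  shows "\<exists>\<psi>. is_copy (antichain_poset k) (boolean_lattice N) \<psi> \<and> rainbow c (\<psi> ` Field (antichain_poset k))"
proof -
  have M: "finite M" "card M = k" "\<forall>A\<in>M. A \<subset> {1..N}" "\<forall>A\<in>M. \<forall>B\<in>M. A \<subseteq> B \<longrightarrow> A = B" "inj_on c M"
    using assms unfolding rainbow_antichain_def by auto
  obtain \<psi> where bij: "bij_betw \<psi> {1..k} M"
    using ex_bij_betw_nat_finite_1[OF M(1)] M(2) by blast
  then have im: "\<psi> ` {1..k} = M" and inj: "inj_on \<psi> {1..k}"
    by (auto simp: bij_betw_def)
  have "(x, y) \<in> antichain_poset k \<longleftrightarrow> (\<psi> x, \<psi> y) \<in> boolean_lattice N" if "x \<in> {1..k}" "y \<in> {1..k}" for x y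
  proof -
    have \<psi>: "\<psi> x \<in> M" "\<psi> y \<in> M"
      using im that by auto
    then have "\<psi> x \<subseteq> \<psi> y \<longleftrightarrow> x = y"
      using M(4) inj_onD[OF inj _ that] by auto
    moreover have "\<psi> y \<subseteq> {1..N}"
      using M(3) \<psi> by auto
    ultimately show ?thesis
      using that by (auto simp: antichain_poset_def boolean_lattice_def)
  qed
  then have "is_copy (antichain_poset k) (boolean_lattice N) \<psi>"
    using im inj M(3) unfolding is_copy_def Field_antichain_poset Field_boolean_lattice by auto
  moreover have "rainbow c (\<psi> ` Field (antichain_poset k))"
    using M(5) im unfolding rainbow_def Field_antichain_poset by (auto simp: inj_on_def)
  ultimately show ?thesis by blast
qed

section \<open>The lower bound\<close>

text \<open>The levels strictly between bottom and top are cut into blocks of \<open>n\<close> consecutive levels; bottom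
  and top get colors of their own.\<close>

definition block_color :: "nat \<Rightarrow> nat \<Rightarrow> nat \<Rightarrow> nat set \<Rightarrow> nat" where
  "block_color n k N A = (if A = {1..N} then k else (card A + n - 1) div n)"

text \<open>Off the top, the color is |A| / n rounded up. The root and the branch of length
  \<open>n\<close> form a chain whose sizes spread over at least \<open>n\<close>, too far to fit
  into one block of \<open>n\<close> levels.\<close>

lemma no_monochromatic_V:
  assumes "1 \<le> n" "1 \<le> k" "N \<le> n * (k - 1) + 1" "is_copy (V_poset m n) (boolean_lattice N) \<phi>"
  shows "\<not> monochromatic (block_color n k N) (\<phi> ` Field (V_poset m n))"
proof
  assume mono: "monochromatic (block_color n k N) (\<phi> ` Field (V_poset m n))"
  have sub: "\<phi> v \<subseteq> {1..N}" if "v \<in> V_carrier m n" for v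
    using assms(4) that unfolding is_copy_def Field_V_poset Field_boolean_lattice by blast
  have fin: "finite (\<phi> v)" if "v \<in> V_carrier m n" for v
    using sub[OF that] finite_subset by blast
  have less: "card (\<phi> v) < card (\<phi> w)" if "(v, w) \<in> V_poset m n" "v \<noteq> w" for v w
  proof -
    have vw: "v \<in> V_carrier m n" "w \<in> V_carrier m n"
      using that(1) V_poset_iff by auto
    then have "\<phi> v \<subseteq> \<phi> w" "\<phi> v \<noteq> \<phi> w"
      using assms(4) that unfolding is_copy_def Field_V_poset by (auto simp: boolean_lattice_def inj_on_def)
    then show ?thesis
      using fin[OF vw(2)] by (simp add: psubset_card_mono psubset_eq)
  qed
  have step: "card (\<phi> VX) + i \<le> card (\<phi> (VZ i))" if "1 \<le> i" "i \<le> n" for i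
    using that
  proof (induction i rule: dec_induct)
    case base
    then have "card (\<phi> VX) < card (\<phi> (VZ 1))"
      by (intro less) (auto simp: V_poset_iff V_carrier_def)
    then show ?case
      by simp
  next
    case (step i)
    then have "card (\<phi> (VZ i)) < card (\<phi> (VZ (Suc i)))"
      by (intro less) (auto simp: V_poset_iff V_carrier_def)
    then show ?case
      using step by simp
  qed
  let ?x = "\<phi> VX" and ?z = "\<phi> (VZ n)"
  have carrier: "VX \<in> V_carrier m n" "VZ n \<in> V_carrier m n"
    using assms(1) by (auto simp: V_carrier_def)
  have eq: "block_color n k N ?x = block_color n k N ?z"
    using mono carrier unfolding monochromatic_def Field_V_poset by blast
  have card: "card ?x + n \<le> card ?z"
    using step[of n] assms(1) by simp
  have le: "card ?z \<le> N"
    using sub[OF carrier(2)] card_mono[of "{1..N}"] by fastforce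
  have x: "?x \<noteq> {1..N}"
    using card le assms(1) by auto
  have "(card ?x + n - 1) div n < block_color n k N ?z"
  proof (cases "?z = {1..N}")
    case True
    \<comment> \<open>The root is at least \<open>n\<close> levels below the top, so its block has
      index at most k - 1, while the top has color \<open>k\<close>.\<close>
    have "card ?x + n - 1 \<le> n * (k - 1)"
      using card le assms(3) by simp
    then have "(card ?x + n - 1) div n \<le> k - 1"
      using assms(1) by (metis div_le_mono nonzero_mult_div_cancel_left not_one_le_zero)
    then show ?thesis
      using True assms(2) by (simp add: block_color_def)
  next
    case False
    have "(card ?x + n - 1) div n + 1 = (card ?x + n - 1 + n) div n"
      by (rule div_add_self2[symmetric]) (use assms(1) in simp)
    also have "\<dots> \<le> (card ?z + n - 1) div n"
      using card assms(1) by (intro div_le_mono) simp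
    finally show ?thesis
      using False by (simp add: block_color_def)
  qed
  then show False
    using eq x by (simp add: block_color_def)
qed

text \<open>As k is at least 2, each member has an incomparable partner and is neither bottom nor
  top. The levels in between are at most n (k - 1) and carry only the colors 1 to k - 1, so two
  members share a color.\<close>

lemma no_rainbow_antichain:
  assumes "1 \<le> n" "2 \<le> k" "N \<le> n * (k - 1) + 1" "is_copy (antichain_poset k) (boolean_lattice N) \<psi>"
  shows "\<not> rainbow (block_color n k N) (\<psi> ` Field (antichain_poset k))"
proof
  assume rainbow: "rainbow (block_color n k N) (\<psi> ` Field (antichain_poset k))"
  have inj: "inj_on \<psi> {1..k}" and im: "\<psi> ` {1..k} \<subseteq> Pow {1..N}"
    and iff: "\<forall>x\<in>{1..k}. \<forall>y\<in>{1..k}. (x, y) \<in> antichain_poset k \<longleftrightarrow> (\<psi> x, \<psi> y) \<in> boolean_lattice N"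
    using assms(4) unfolding is_copy_def Field_antichain_poset Field_boolean_lattice by simp_all
  have sub: "\<psi> x \<subseteq> {1..N}" if "x \<in> {1..k}" for x
    using im that by blast
  have inc: "x = y" if xy: "x \<in> {1..k}" "y \<in> {1..k}" "\<psi> x \<subseteq> \<psi> y" for x y
  proof -
    have "(\<psi> x, \<psi> y) \<in> boolean_lattice N"
      using xy(3) sub[OF xy(2)] by (simp add: boolean_lattice_def)
    then have "(x, y) \<in> antichain_poset k"
      using iff xy(1,2) by simp
    then show ?thesis
      by (auto simp: antichain_poset_def)
  qed
  have range: "block_color n k N (\<psi> x) \<in> {1..k - 1}" if x: "x \<in> {1..k}" for x
  proof -
    obtain y where y: "y \<in> {1..k}" "y \<noteq> x"
      using assms(2) by (metis One_nat_def Suc_1 Suc_leD Suc_n_not_le_n atLeastAtMost_iff le_refl)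
    then have "\<not> \<psi> x \<subseteq> \<psi> y" "\<not> \<psi> y \<subseteq> \<psi> x"
      using inc x by blast+
    then have "\<psi> x \<noteq> {}" "\<psi> x \<subset> {1..N}"
      using sub[OF x] sub[OF y(1)] by blast+
    then have "0 < card (\<psi> x)" "card (\<psi> x) < N"
      using psubset_card_mono[of "{1..N}" "\<psi> x"] by (auto simp: card_gt_0_iff intro: finite_subset)
    then have "n \<le> card (\<psi> x) + n - 1" "card (\<psi> x) + n - 1 < n * k"
      using assms by (auto simp: algebra_simps diff_mult_distrib2)
    then have "1 \<le> (card (\<psi> x) + n - 1) div n" "(card (\<psi> x) + n - 1) div n < k"
      using assms(1) by (auto simp: div_greater_zero_iff Suc_le_eq less_mult_imp_div_less mult.commute)
    then show ?thesis
      using \<open>\<psi> x \<subset> {1..N}\<close> by (auto simp: block_color_def)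
  qed
  have "inj_on (block_color n k N \<circ> \<psi>) {1..k}"
    using rainbow inj unfolding rainbow_def Field_antichain_poset inj_on_def by (metis comp_apply imageI)
  then have "card {1..k} \<le> card {1..k - 1}"
    using range by (intro card_inj_on_le[of "block_color n k N \<circ> \<psi>"]) auto
  then show False
    using assms(2) by simp
qed

section \<open>Combination of the two bounds\<close>

theorem theorem6:
  fixes k m n :: nat
  assumes "k \<ge> 2" and "1 \<le> m" and "m < n"
  shows "RR (V_poset m n) (antichain_poset k) = enat (n * (k - 1) + 2)"
  unfolding RR_eq_enat_iff
proof (intro conjI allI impI)
  let ?N = "n * (k - 1) + 2"
  show "rainbow_arrows ?N (V_poset m n) (antichain_poset k)"
    unfolding rainbow_arrows_def
  proof
    fix c :: "nat set \<Rightarrow> nat"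
    show "(\<exists>\<phi>. is_copy (V_poset m n) (boolean_lattice ?N) \<phi> \<and> monochromatic c (\<phi> ` Field (V_poset m n))) \<or>
        (\<exists>\<psi>. is_copy (antichain_poset k) (boolean_lattice ?N) \<psi> \<and> rainbow c (\<psi> ` Field (antichain_poset k)))"
    proof (cases "vee c m n {1..?N}")
      case True
      then show ?thesis
        using copy_if_vee[of m n c ?N] assms by simp
    next
      case False
      \<comment> \<open>The index of \<open>rainbow_antichain_exists\<close> is one less than the
        size of the antichain; with empty lower end, |T - J| meets its threshold exactly.\<close>
      then have "\<exists>M. rainbow_antichain c (Suc (k - 1)) {} {1..?N} M"
        using assms by (intro rainbow_antichain_exists[of m n]) auto
      then show ?thesis
        using copy_if_rainbow_antichain[of c k "{}" ?N] assms(1) by auto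
    qed
  qed
next
  fix M assume "M < n * (k - 1) + 2"
  then have M: "M \<le> n * (k - 1) + 1" by simp
  show "\<not> rainbow_arrows M (V_poset m n) (antichain_poset k)"
    unfolding rainbow_arrows_def not_all
    using no_monochromatic_V[of n k M m] no_rainbow_antichain[of n k M] M assms
    by (intro exI[of _ "block_color n k M"]) auto
qed

end
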